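(* (Maximum entropy principle for matrix recovery.) Let $\mathbf{X}\in\mathbb{R}^{m_1\times m_2}$ be the unknown (random) low-rank matrix, and for measurement masks $\mathbf{A}_{1:n}=[\mathbf{A}_1\ \cdots\ \mathbf{A}_n]$ let $\mathbf{y}_{\mathbf{A}_{1:n}}=\mathcal{A}(\mathbf{X})+\boldsymbol{\epsilon}\in\mathbb{R}^n$ be the observations taken from these masks, where $\mathcal{A}(\mathbf{X})=(\langle\mathbf{A}_i,\mathbf{X}\rangle_F)_{i=1}^n$ and the noise $\boldsymbol{\epsilon}$ is independent of $\mathbf{X}$. Then $$\mathrm{H}(\mathbf{y}_{\mathbf{A}_{1:n}})+\mathrm{H}(\mathbf{X}\mid\mathbf{y}_{\mathbf{A}_{1:n}})=\mathrm{H}(\mathbf{y}_{\mathbf{A}_{1:n}},\mathbf{X})=\mathrm{H}(\mathbf{X})+\mathrm{H}(\boldsymbol{\epsilon}),$$ and the right-hand side does not depend on the choice of masks $\mathbf{A}_{1:n}$. Hence the masks $\mathbf{A}_{1:n}$ which minimize the conditional entropy $\mathrm{H}(\mathbf{X}\mid\mathbf{y}_{\mathbf{A}_{1:n}})$ also maximize the observation entropy $\mathrm{H}(\mathbf{y}_{\mathbf{A}_{1:n}})$, and maximizing $\mathrm{H}(\mathbf{y}_{\mathbf{A}_{1:n}})$ is equivalent to minimizing $\mathrm{H}(\mathbf{X}\mid\mathbf{y}_{\mathbf{A}_{1:n}})$; that is, a mask design which maximizes the entropy of the observations in turn maximizes the information gain on $\mathbf{X}$.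
   Context: The masks are $\mathbf{A}_i\in\mathbb{R}^{m_1\times m_2}$ with the unit power constraint $\|\mathbf{A}_i\|_F^2\le1$; $\langle\mathbf{A},\mathbf{X}\rangle_F=\mathrm{tr}(\mathbf{A}^T\mathbf{X})$; $\boldsymbol{\epsilon}=(\epsilon_i)_{i=1}^n$ has i.i.d. $\mathcal{N}(0,\eta^2)$ entries. The low-rank matrix is modelled by the singular matrix-variate Gaussian distribution: $\mathbf{X}=\mathcal{P}_{\mathcal{U}}\mathbf{Z}\mathcal{P}_{\mathcal{V}}$ in distribution, where $\mathbf{Z}$ has i.i.d. $\mathcal{N}(0,\sigma^2)$ entries and $\mathcal{P}_{\mathcal{U}},\mathcal{P}_{\mathcal{V}}$ are orthogonal projection matrices onto $R$-dimensional subspaces $\mathcal{U}\subseteq\mathbb{R}^{m_1}$, $\mathcal{V}\subseteq\mathbb{R}^{m_2}$, with $R<\min(m_1,m_2)$. For random variables $(X,Y)$ with marginal densities $f_X,f_Y$ and joint density $f_{X,Y}$, the entropy of $X$ is $\mathrm{H}(X)=\mathbb{E}[-\log f_X(X)]$, the joint entropy is $\mathrm{H}(X,Y)=\mathbb{E}[-\log f_{X,Y}(X,Y)]$, and the conditional entropy $\mathrm{H}(Y\mid X)$ is the entropy of the conditional random variable $Y\mid X$; these satisfy the chain rule $\mathrm{H}(X,Y)=\mathrm{H}(X)+\mathrm{H}(Y\mid X)$. "Maximizing the information gain on $\mathbf{X}$" means minimizing $\mathrm{H}(\mathbf{X}\mid\mathbf{y}_{\mathbf{A}_{1:n}})$.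 *)

theory Defs
  imports "HOL-Probability.Probability"
begin

definition frobenius_inner :: "real^'m2^'m1 \<Rightarrow> real^'m2^'m1 \<Rightarrow> real" where
  "frobenius_inner A X = trace (transpose A ** X)"

text \<open>A design is a family of \<open>n = CARD('n)\<close> masks obeying the unit power constraint.\<close>

definition unit_power :: "('n::finite \<Rightarrow> real^'m2^'m1) \<Rightarrow> bool" where
  "unit_power A \<longleftrightarrow> (\<forall>i. frobenius_inner (A i) (A i) \<le> 1)"

definition observations ::
  "('n::finite \<Rightarrow> real^'m2^'m1) \<Rightarrow> ('w \<Rightarrow> real^'m2^'m1) \<Rightarrow> ('w \<Rightarrow> real^'n) \<Rightarrow> 'w \<Rightarrow> real^'n" where
  "observations A X noise = (\<lambda>\<omega>. (\<chi> i. frobenius_inner (A i) (X \<omega>)) + noise \<omega>)"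

definition iid_normal :: "'w measure \<Rightarrow> real \<Rightarrow> ('i \<Rightarrow> 'w \<Rightarrow> real) \<Rightarrow> bool" where
  "iid_normal M s W \<longleftrightarrow>
     prob_space.indep_vars M (\<lambda>_. borel) W UNIV \<and>
     (\<forall>i. distributed M lborel (W i) (normal_density 0 s))"

text \<open>
  The library's \<open>indep_var\<close> requires both variables to have the same codomain type, so
  independence is stated for the generated \<open>\<sigma>\<close>-algebras.
\<close>

definition indep_random_vars ::
  "'w measure \<Rightarrow> 'b measure \<Rightarrow> ('w \<Rightarrow> 'b) \<Rightarrow> 'c measure \<Rightarrow> ('w \<Rightarrow> 'c) \<Rightarrow> bool" where
  "indep_random_vars M S X T Y \<longleftrightarrow>
     X \<in> measurable M S \<and> Y \<in> measurable M T \<and>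
     prob_space.indep_set M (sets (vimage_algebra (space M) X S)) (sets (vimage_algebra (space M) Y T))"

definition is_orthogonal_projection :: "real^'n^'n \<Rightarrow> (real^'n) set \<Rightarrow> bool" where
  "is_orthogonal_projection P S \<longleftrightarrow>
     (\<forall>x. P *v x \<in> S \<and> (\<forall>s\<in>S. orthogonal (x - P *v x) s))"

text \<open>
  Lebesgue measure on a linear subspace \<open>S\<close>, as a measure on the Borel sets of the ambient
  space: the image of product Lebesgue measure under the coordinates of an orthonormal basis
  of \<open>S\<close> (for \<open>S = UNIV\<close> and the standard basis this is how \<^const>\<open>lborel\<close> is
  built).  Such a basis exists by \<open>orthonormal_basis_subspace\<close>, and the measure does not
  depend on which one is chosen, since Lebesgue measure is invariant under orthogonal maps.
\<close>

definition lborel_on :: "'a::euclidean_space set \<Rightarrow> 'a measure" where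
  "lborel_on S =
     (let B = (SOME B. pairwise orthogonal B \<and> (\<forall>b\<in>B. norm b = 1) \<and> span B = S)
      in distr (\<Pi>\<^sub>M b\<in>B. (lborel :: real measure)) borel (\<lambda>c. \<Sum>b\<in>B. c b *\<^sub>R b))"

text \<open>
  The matrix \<open>P ** Z ** Q\<close> takes values in the proper subspace below, so it has no density
  with respect to Lebesgue measure on the space of all matrices; its density, and with it
  its entropy, refers to Lebesgue measure on this subspace.
\<close>

definition smg_support :: "real^'m1^'m1 \<Rightarrow> real^'m2^'m2 \<Rightarrow> (real^'m2^'m1) set" where
  "smg_support P Q = range (\<lambda>W. P ** W ** Q)"

text \<open>
  Entropies are taken to the natural logarithm. The arguments \<open>S\<close>, \<open>T\<close> are the
  reference measures for the densities of \<open>X\<close>, \<open>Y\<close>. The library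
  constants unfold to \<open>E[- ln f(X)]\<close> and \<open>E[- ln (f(X,Y) / f(Y))]\<close>.
\<close>

abbreviation entropy_ln :: "'w measure \<Rightarrow> 'b measure \<Rightarrow> ('w \<Rightarrow> 'b) \<Rightarrow> real" where
  "entropy_ln M S X \<equiv> prob_space.entropy M (exp 1) S X"

abbreviation joint_entropy_ln ::
  "'w measure \<Rightarrow> 'b measure \<Rightarrow> 'c measure \<Rightarrow> ('w \<Rightarrow> 'b) \<Rightarrow> ('w \<Rightarrow> 'c) \<Rightarrow> real" where
  "joint_entropy_ln M S T X Y \<equiv> prob_space.entropy M (exp 1) (S \<Otimes>\<^sub>M T) (\<lambda>\<omega>. (X \<omega>, Y \<omega>))"

text \<open>Entropy of \<open>X\<close> given \<open>Y\<close>.\<close>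

abbreviation cond_entropy_ln ::
  "'w measure \<Rightarrow> 'b measure \<Rightarrow> 'c measure \<Rightarrow> ('w \<Rightarrow> 'b) \<Rightarrow> ('w \<Rightarrow> 'c) \<Rightarrow> real" where
  "cond_entropy_ln M S T X Y \<equiv> prob_space.conditional_entropy M (exp 1) S T X Y"

end

theory Submission
  imports Defs
begin

text \<open>
  The joint law of the observation \<open>Y = L X + noise\<close> and \<open>X\<close> has density
  \<open>(y, x) \<mapsto> g (y - L x) * f x\<close>, whose logarithm at \<open>(Y, X)\<close> is \<open>ln (g noise) + ln (f X)\<close>;
  hence the joint entropy is that of \<open>X\<close> plus that of the noise, whatever \<open>L\<close> is.

  The chain rule needs integrable log densities. Lebesgue measure does not depend
  on the orthonormal basis used to define it, so the projected Gaussian matrix has a Gaussian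
  density on its support, and the logarithms of \<open>f\<close> and \<open>g\<close> are quadratic. The density
  \<open>y \<mapsto> E[g (y - L X)]\<close> of \<open>Y\<close> is bounded above because \<open>g\<close> is, and below, by Jensen's
  inequality for \<open>exp\<close>, by a Gaussian; so its logarithm grows at most quadratically and is
  integrable because \<open>Y\<close> has second moments.
\<close>

section \<open>Gaussian vectors in orthonormal coordinates\<close>

text \<open>The family is indexed, so one development serves basis sets (with the identity as
  \<open>e\<close>), the unit vectors of \<open>real^'n\<close> and the matrix units, which are
  indexed by pairs.\<close>

definition orthonormal_family :: "('i \<Rightarrow> 'a::real_inner) \<Rightarrow> 'i set \<Rightarrow> bool" where
  "orthonormal_family e I \<longleftrightarrow>
     finite I \<and> (\<forall>i\<in>I. \<forall>j\<in>I. e i \<bullet> e j = (if i = j then 1 else 0))"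

definition from_coords :: "('i \<Rightarrow> 'a::real_vector) \<Rightarrow> 'i set \<Rightarrow> ('i \<Rightarrow> real) \<Rightarrow> 'a" where
  "from_coords e I c = (\<Sum>i\<in>I. c i *\<^sub>R e i)"

text \<open>The centred isotropic normal density with variance \<open>s\<^sup>2\<close> in
  \<open>k\<close> dimensions. The exponent \<open>k\<close> is a separate parameter because the
  density on a subspace has its dimension as exponent while its argument lives in the ambient
  space.\<close>

definition gauss :: "real \<Rightarrow> nat \<Rightarrow> 'a::real_normed_vector \<Rightarrow> real" where
  "gauss s k x = (1 / sqrt (2 * pi * s\<^sup>2)) ^ k * exp (- (norm x)\<^sup>2 / (2 * s\<^sup>2))"

lemma gauss_pos: "s > 0 \<Longrightarrow> gauss s k x > 0"
  by (simp add: gauss_def)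

lemma gauss_nonneg [simp]: "0 \<le> gauss s k x"
  by (simp add: gauss_def)

lemma gauss_minus [simp]: "gauss s k (- x) = gauss s k x"
  by (simp add: gauss_def)

lemma borel_measurable_gauss [measurable]: "gauss s k \<in> borel_measurable borel"
  unfolding gauss_def[abs_def] by measurable

lemma ln_gauss:
  assumes "s > 0"
  shows "ln (gauss s k x) = real k * ln (1 / sqrt (2 * pi * s\<^sup>2)) - (norm x)\<^sup>2 / (2 * s\<^sup>2)"
proof -
  have "0 < 1 / sqrt (2 * pi * s\<^sup>2)" using assms by simp
  then show ?thesis
    unfolding gauss_def
    by (subst ln_mult) (use assms in \<open>auto simp: ln_realpow\<close>)
qed

lemma gauss_le:
  assumes "s > 0"
  shows "gauss s k x \<le> (1 / sqrt (2 * pi * s\<^sup>2)) ^ k"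
  unfolding gauss_def by (intro mult_left_le) (use assms in auto)

lemma orthonormal_family_inner:
  "orthonormal_family e I \<Longrightarrow> i \<in> I \<Longrightarrow> j \<in> I \<Longrightarrow> e i \<bullet> e j = (if i = j then 1 else 0)"
  by (simp add: orthonormal_family_def)

lemma orthonormal_family_Basis: "orthonormal_family (\<lambda>b. b) (Basis :: 'a::euclidean_space set)"
  by (auto simp: orthonormal_family_def inner_Basis)

text \<open>Nonzero pairwise orthogonal vectors are independent. The count fixes the exponent of
  \<open>gauss\<close>.\<close>

lemma orthonormal_family_card_span:
  fixes e :: "'i \<Rightarrow> 'a::euclidean_space"
  assumes on: "orthonormal_family e I"
  shows "card I = dim (span (e ` I))"
proof -
  have inj: "inj_on e I"
  proof (rule inj_onI)
    fix i j assume "i \<in> I" "j \<in> I" "e i = e j"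
    then have "e i \<bullet> e j = 1" using on by (auto simp: orthonormal_family_def)
    then show "i = j" using on \<open>i \<in> I\<close> \<open>j \<in> I\<close> by (auto simp: orthonormal_family_def split: if_splits)
  qed
  have "independent (e ` I)"
  proof (rule pairwise_orthogonal_independent)
    show "pairwise orthogonal (e ` I)"
      using on by (auto simp: pairwise_def orthogonal_def orthonormal_family_def)
    show "0 \<notin> e ` I"
    proof
      assume "0 \<in> e ` I"
      then obtain i where i: "i \<in> I" "e i = 0" by auto
      show False using orthonormal_family_inner[OF on i(1) i(1)] i(2) by simp
    qed
  qed
  then show ?thesis
    using inj by (simp add: dim_eq_card_independent card_image)
qed

lemma inner_from_coords:
  assumes "orthonormal_family e I" "i \<in> I"
  shows "from_coords e I c \<bullet> e i = c i"
proof -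
  have "from_coords e I c \<bullet> e i = (\<Sum>j\<in>I. c j * (if j = i then 1 else 0))"
    unfolding from_coords_def inner_sum_left using assms
    by (intro sum.cong) (auto simp: orthonormal_family_def)
  also have "\<dots> = c i" using assms by (simp add: orthonormal_family_def if_distrib[of "(*) _"] cong: if_cong)
  finally show ?thesis .
qed

lemma norm_from_coords:
  assumes "orthonormal_family e I"
  shows "(norm (from_coords e I c))\<^sup>2 = (\<Sum>i\<in>I. (c i)\<^sup>2)"
proof -
  have "(norm (from_coords e I c))\<^sup>2 = (\<Sum>i\<in>I. c i * (from_coords e I c \<bullet> e i))"
    by (simp add: power2_norm_eq_inner from_coords_def[of e I] inner_sum_right)
  then show ?thesis using inner_from_coords[OF assms] by (simp add: power2_eq_square)
qed

text \<open>Both sides lie in the span and have the same inner product with every spanning vector,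
  which determines a vector of the span.\<close>

lemma from_coords_inner:
  assumes on: "orthonormal_family e I" and x: "x \<in> span (e ` I)"
  shows "from_coords e I (\<lambda>i. x \<bullet> e i) = x"
proof -
  have fin: "finite I" using on by (simp add: orthonormal_family_def)
  have "from_coords e I (\<lambda>i. x \<bullet> e i) \<in> span (e ` I)"
    unfolding from_coords_def by (intro span_sum span_scale span_base) auto
  moreover have "\<And>y. y \<in> e ` I \<Longrightarrow> from_coords e I (\<lambda>i. x \<bullet> e i) \<bullet> y = x \<bullet> y"
    using inner_from_coords[OF on] by auto
  ultimately show ?thesis
    using vector_eq_dot_span[OF _ x] by (metis inner_commute)
qed

lemma from_coords_restrict [simp]: "from_coords e I (restrict c I) = from_coords e I c"
  by (simp add: from_coords_def)

lemma from_coords_measurable [measurable]: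
  fixes e :: "'i \<Rightarrow> 'a::euclidean_space"
  assumes [measurable_cong]: "\<And>i. i \<in> I \<Longrightarrow> sets (K i) = sets borel"
  shows "from_coords e I \<in> Pi\<^sub>M I K \<rightarrow>\<^sub>M borel"
proof -
  have "(\<lambda>c. c i) \<in> Pi\<^sub>M I K \<rightarrow>\<^sub>M borel" if "i \<in> I" for i
    using measurable_component_singleton[OF that, of K] assms[OF that]
    by (simp cong: measurable_cong_sets)
  then show ?thesis unfolding from_coords_def[abs_def] by measurable
qed

text \<open>By Parseval the squared norm is the sum of the squared coordinates, and
  \<open>exp\<close> turns that sum into a product.\<close>

lemma gauss_from_coords:
  assumes "orthonormal_family e I"
  shows "gauss s (card I) (from_coords e I c) = (\<Prod>i\<in>I. normal_density 0 s (c i))"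
proof -
  have fin: "finite I" using assms by (simp add: orthonormal_family_def)
  show ?thesis
    unfolding gauss_def normal_density_def norm_from_coords[OF assms] prod.distrib
    by (simp add: exp_sum[OF fin, symmetric] sum_divide_distrib sum_negf)
qed

section \<open>Product densities and invariance of product Lebesgue measure\<close>

text \<open>Both measures agree on boxes, since the indicator of a box factorizes and the integral
  of a product of one-variable functions is the product of the integrals. Boxes determine the
  measure because the weighted factors are sigma-finite by \<open>sf\<close>.\<close>

lemma (in product_sigma_finite) density_PiM:
  assumes "finite I"
    and f: "\<And>i. i \<in> I \<Longrightarrow> f i \<in> borel_measurable (M i)"
    and sf: "product_sigma_finite (\<lambda>i. density (M i) (f i))"
  shows "density (Pi\<^sub>M I M) (\<lambda>c. \<Prod>i\<in>I. f i (c i)) = Pi\<^sub>M I (\<lambda>i. density (M i) (f i))"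
proof (rule product_sigma_finite.PiM_eqI[OF sf \<open>finite I\<close>])
  show "sets (density (Pi\<^sub>M I M) (\<lambda>c. \<Prod>i\<in>I. f i (c i))) = sets (Pi\<^sub>M I (\<lambda>i. density (M i) (f i)))"
    by (simp cong: sets_PiM_cong)
next
  fix A assume A: "\<And>i. i \<in> I \<Longrightarrow> A i \<in> sets (density (M i) (f i))"
  have [measurable]: "(\<lambda>c. \<Prod>i\<in>I. f i (c i)) \<in> borel_measurable (Pi\<^sub>M I M)"
  proof (rule borel_measurable_prod_ennreal)
    fix i assume "i \<in> I"
    then show "(\<lambda>c. f i (c i)) \<in> borel_measurable (Pi\<^sub>M I M)"
      using measurable_compose[OF measurable_component_singleton[of i I M] f[of i]] by simp
  qed
  have [measurable]: "Pi\<^sub>E I A \<in> sets (Pi\<^sub>M I M)"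
    using A assms(1) by (intro sets_PiM_I_finite) auto
  have "emeasure (density (Pi\<^sub>M I M) (\<lambda>c. \<Prod>i\<in>I. f i (c i))) (Pi\<^sub>E I A)
      = (\<integral>\<^sup>+c. (\<Prod>i\<in>I. f i (c i)) * indicator (Pi\<^sub>E I A) c \<partial>Pi\<^sub>M I M)"
    by (subst emeasure_density) auto
  also have "\<dots> = (\<integral>\<^sup>+c. (\<Prod>i\<in>I. f i (c i) * indicator (A i) (c i)) \<partial>Pi\<^sub>M I M)"
  proof (rule nn_integral_cong)
    fix c assume c: "c \<in> space (Pi\<^sub>M I M)"
    have "indicator (Pi\<^sub>E I A) c = (\<Prod>i\<in>I. indicator (A i) (c i) :: ennreal)"
      using c \<open>finite I\<close> by (auto simp: indicator_def space_PiM PiE_iff prod_zero_iff)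
    then show "(\<Prod>i\<in>I. f i (c i)) * indicator (Pi\<^sub>E I A) c = (\<Prod>i\<in>I. f i (c i) * indicator (A i) (c i))"
      by (simp add: prod.distrib)
  qed
  also have "\<dots> = (\<Prod>i\<in>I. \<integral>\<^sup>+x. f i x * indicator (A i) x \<partial>M i)"
    using A f by (intro product_nn_integral_prod \<open>finite I\<close>) (auto intro!: borel_measurable_times_ennreal borel_measurable_indicator)
  also have "\<dots> = (\<Prod>i\<in>I. emeasure (density (M i) (f i)) (A i))"
    using A f by (intro prod.cong refl) (subst emeasure_density, auto)
  finally show "emeasure (density (Pi\<^sub>M I M) (\<lambda>c. \<Prod>i\<in>I. f i (c i))) (Pi\<^sub>E I A)
    = (\<Prod>i\<in>I. emeasure (density (M i) (f i)) (A i))" .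
qed

interpretation lborel_prod: product_sigma_finite "\<lambda>_. lborel :: real measure"
  by unfold_locales

text \<open>The preimage of a box under a translation is a box with translated sides, so invariance
  on the line suffices. The restriction to \<open>I\<close> keeps the shifted functions in the space
  of the product measure.\<close>

lemma PiM_lborel_translate:
  assumes "finite I"
  shows "distr (Pi\<^sub>M I (\<lambda>_. lborel :: real measure)) (Pi\<^sub>M I (\<lambda>_. lborel)) (\<lambda>c. \<lambda>i\<in>I. a i + c i)
    = Pi\<^sub>M I (\<lambda>_. lborel)"
proof (rule lborel_prod.PiM_eqI[OF assms])
  fix A :: "'a \<Rightarrow> real set" assume A: "\<And>i. i \<in> I \<Longrightarrow> A i \<in> sets lborel"
  have "emeasure (distr (Pi\<^sub>M I (\<lambda>_. lborel)) (Pi\<^sub>M I (\<lambda>_. lborel)) (\<lambda>c. \<lambda>i\<in>I. a i + c i)) (Pi\<^sub>E I A)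
      = emeasure (Pi\<^sub>M I (\<lambda>_. lborel)) ((\<lambda>c. \<lambda>i\<in>I. a i + c i) -` Pi\<^sub>E I A \<inter> space (Pi\<^sub>M I (\<lambda>_. lborel)))"
    using A assms by (intro emeasure_distr sets_PiM_I_finite) auto
  also have "(\<lambda>c. \<lambda>i\<in>I. a i + c i) -` Pi\<^sub>E I A \<inter> space (Pi\<^sub>M I (\<lambda>_. lborel))
      = Pi\<^sub>E I (\<lambda>i. (+) (a i) -` A i)"
    by (auto simp: space_PiM PiE_iff)
  also have "emeasure (Pi\<^sub>M I (\<lambda>_. lborel)) \<dots> = (\<Prod>i\<in>I. emeasure lborel ((+) (a i) -` A i))"
    using A assms by (intro lborel_prod.emeasure_PiM) (auto intro!: measurable_sets_borel[where M=borel])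
  also have "\<dots> = (\<Prod>i\<in>I. emeasure (distr lborel borel ((+) (a i))) (A i))"
    using A by (intro prod.cong refl) (subst emeasure_distr, auto)
  also have "\<dots> = (\<Prod>i\<in>I. emeasure lborel (A i))"
    by (simp only: lborel_distr_plus)
  finally show "emeasure (distr (Pi\<^sub>M I (\<lambda>_. lborel)) (Pi\<^sub>M I (\<lambda>_. lborel)) (\<lambda>c. \<lambda>i\<in>I. a i + c i)) (Pi\<^sub>E I A)
      = (\<Prod>i\<in>I. emeasure lborel (A i))" .
qed simp

text \<open>Adding a vector of the span amounts to shifting the coordinates by its own coordinates
  \<open>a \<bullet> e i\<close>.\<close>

lemma nn_integral_from_coords_translate:
  fixes e :: "'i \<Rightarrow> 'a::euclidean_space"
  assumes on: "orthonormal_family e I" and a: "a \<in> span (e ` I)"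
    and [measurable]: "g \<in> borel_measurable borel"
  shows "(\<integral>\<^sup>+c. g (a + from_coords e I c) \<partial>Pi\<^sub>M I (\<lambda>_. lborel))
    = (\<integral>\<^sup>+c. g (from_coords e I c) \<partial>Pi\<^sub>M I (\<lambda>_. lborel))"
proof -
  have fin: "finite I" using on by (simp add: orthonormal_family_def)
  have "a + from_coords e I c = from_coords e I (\<lambda>i\<in>I. a \<bullet> e i + c i)" for c
  proof -
    have "a + from_coords e I c = from_coords e I (\<lambda>i. a \<bullet> e i) + from_coords e I c"
      by (simp add: from_coords_inner[OF on a])
    then show ?thesis by (simp add: from_coords_def sum.distrib scaleR_add_left)
  qed
  then show ?thesis
    by (subst (2) PiM_lborel_translate[OF fin, symmetric, of "\<lambda>i. a \<bullet> e i"])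
      (simp add: nn_integral_distr)
qed

lemma nn_integral_gauss_from_coords:
  fixes e :: "'i \<Rightarrow> 'a::euclidean_space"
  assumes on: "orthonormal_family e I" and "s > 0"
  shows "(\<integral>\<^sup>+c. gauss s (card I) (from_coords e I c) \<partial>Pi\<^sub>M I (\<lambda>_. lborel)) = 1"
proof -
  have fin: "finite I" using on by (simp add: orthonormal_family_def)
  have "(\<integral>\<^sup>+c. gauss s (card I) (from_coords e I c) \<partial>Pi\<^sub>M I (\<lambda>_. lborel))
      = (\<integral>\<^sup>+c. (\<Prod>i\<in>I. ennreal (normal_density 0 s (c i))) \<partial>Pi\<^sub>M I (\<lambda>_. lborel))"
    by (simp add: gauss_from_coords[OF on] prod_ennreal)
  also have "\<dots> = (\<Prod>i\<in>I. \<integral>\<^sup>+x. normal_density 0 s x \<partial>lborel)"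
    by (intro lborel_prod.product_nn_integral_prod fin) auto
  also have "\<dots> = 1"
    using \<open>s > 0\<close> by (simp add: nn_integral_eq_integral)
  finally show ?thesis .
qed

text \<open>
  The usual uniqueness argument for Haar measure, by Fubini for the two translation invariant
  measures; the two normalizations agree because a Gaussian density integrates to one for both.
\<close>

lemma lborel_eq_orthonormal:
  fixes e :: "'i \<Rightarrow> 'a::euclidean_space"
  assumes on: "orthonormal_family e I" and sp: "span (e ` I) = UNIV"
  shows "distr (Pi\<^sub>M I (\<lambda>_. lborel)) borel (from_coords e I) = lborel"
proof (rule measure_eqI)
  fix A assume "A \<in> sets (distr (Pi\<^sub>M I (\<lambda>_. lborel)) borel (from_coords e I))"
  then have A [measurable]: "A \<in> sets borel" by simp
  have fin: "finite I" using on by (simp add: orthonormal_family_def)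
  let ?P = "Pi\<^sub>M I (\<lambda>_. lborel :: real measure)"
  let ?T = "from_coords e I"
  define d where "d = card I"
  have d: "d = DIM('a)"
    using orthonormal_family_card_span[OF on] sp by (simp add: d_def)
  let ?h = "\<lambda>x::'a. ennreal (gauss 1 d x)"
  \<comment> \<open>For the standard basis, \<open>lborel\<close> is by construction an image of
    product Lebesgue measure, so the integral in coordinates applies to it as well.\<close>
  have h_lborel: "(\<integral>\<^sup>+y. ?h y \<partial>lborel) = 1"
    using nn_integral_gauss_from_coords[OF orthonormal_family_Basis, of 1, where 'a='a]
    by (subst lborel_eq) (simp add: nn_integral_distr d from_coords_def[symmetric])
  have h_coords: "(\<integral>\<^sup>+c. ?h (y - ?T c) \<partial>?P) = 1" for y
  proof -
    \<comment> \<open>The Gaussian is even; flipping the sign of its argument exposes a translation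
      by \<open>- y\<close>.\<close>
    have "(\<integral>\<^sup>+c. ?h (y - ?T c) \<partial>?P) = (\<integral>\<^sup>+c. ?h (- y + ?T c) \<partial>?P)"
      using gauss_minus[of 1 d "y - ?T c" for c] by (simp add: algebra_simps)
    also have "\<dots> = (\<integral>\<^sup>+c. ?h (?T c) \<partial>?P)"
      using sp by (intro nn_integral_from_coords_translate[OF on]) auto
    also have "\<dots> = 1"
      unfolding d_def by (rule nn_integral_gauss_from_coords[OF on]) simp
    finally show ?thesis .
  qed
  interpret P: sigma_finite_measure ?P
    using lborel_prod.sigma_finite[OF fin] .
  interpret pair_sigma_finite ?P "lborel :: 'a measure" ..
  let ?i = "indicator A :: 'a \<Rightarrow> ennreal"
  have "emeasure (distr ?P borel ?T) A = (\<integral>\<^sup>+c. ?i (?T c) \<partial>?P)"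
    by (subst nn_integral_indicator[symmetric], simp, subst nn_integral_distr, auto)
  \<comment> \<open>A factor 1 enters as the \<open>lborel\<close> integral of \<open>?h\<close>.
    Two translations and two exchanges of integrals later it leaves as the integral of
    \<open>?h\<close> over the coordinates, with the indicator of \<open>A\<close> moved from one
    measure to the other.\<close>
  also have "\<dots> = (\<integral>\<^sup>+y. ?h y * (\<integral>\<^sup>+c. ?i (?T c) \<partial>?P) \<partial>lborel)"
    by (simp add: nn_integral_multc h_lborel)
  also have "\<dots> = (\<integral>\<^sup>+y. \<integral>\<^sup>+c. ?h y * ?i (y + ?T c) \<partial>?P \<partial>lborel)"
  proof (intro nn_integral_cong)
    fix y :: 'a
    have "(\<integral>\<^sup>+c. ?i (?T c) \<partial>?P) = (\<integral>\<^sup>+c. ?i (y + ?T c) \<partial>?P)"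
      using sp by (intro nn_integral_from_coords_translate[OF on, symmetric]) auto
    then show "?h y * (\<integral>\<^sup>+c. ?i (?T c) \<partial>?P) = (\<integral>\<^sup>+c. ?h y * ?i (y + ?T c) \<partial>?P)"
      by (simp add: nn_integral_cmult)
  qed
  also have "\<dots> = (\<integral>\<^sup>+c. \<integral>\<^sup>+y. ?h y * ?i (y + ?T c) \<partial>lborel \<partial>?P)"
    by (rule Fubini') measurable
  also have "\<dots> = (\<integral>\<^sup>+c. \<integral>\<^sup>+y. ?h (y - ?T c) * ?i y \<partial>lborel \<partial>?P)"
  proof (rule nn_integral_cong)
    fix c
    show "(\<integral>\<^sup>+y. ?h y * ?i (y + ?T c) \<partial>lborel) = (\<integral>\<^sup>+y. ?h (y - ?T c) * ?i y \<partial>lborel)"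
      by (subst (2) lborel_distr_plus[of "?T c", symmetric])
        (simp add: nn_integral_distr add.commute)
  qed
  also have "\<dots> = (\<integral>\<^sup>+y. \<integral>\<^sup>+c. ?h (y - ?T c) * ?i y \<partial>?P \<partial>lborel)"
    by (rule Fubini'[symmetric]) measurable
  also have "\<dots> = emeasure lborel A"
    by (simp add: nn_integral_multc h_coords)
  finally show "emeasure (distr ?P borel ?T) A = emeasure lborel A" .
qed simp

section \<open>Laws and second moments of Gaussian vectors\<close>

text \<open>The product of the normal densities is a function of the assembled vector alone, so it
  passes through the image measure. The family may span a proper subspace, which covers both the
  full Gaussian and the degenerate one.\<close>

lemma distr_gaussian_from_coords:
  fixes e :: "'i \<Rightarrow> 'a::euclidean_space"
  assumes on: "orthonormal_family e I" and "s > 0"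
  shows "distr (Pi\<^sub>M I (\<lambda>_. density lborel (normal_density 0 s))) borel (from_coords e I)
    = density (distr (Pi\<^sub>M I (\<lambda>_. lborel)) borel (from_coords e I)) (gauss s (card I))"
proof -
  have fin: "finite I" using on by (simp add: orthonormal_family_def)
  interpret n: prob_space "density lborel (normal_density 0 s)"
    using \<open>s > 0\<close> by (rule prob_space_normal_density)
  have "Pi\<^sub>M I (\<lambda>_. density lborel (normal_density 0 s))
    = density (Pi\<^sub>M I (\<lambda>_. lborel)) (\<lambda>c. \<Prod>i\<in>I. ennreal (normal_density 0 s (c i)))"
    by (rule lborel_prod.density_PiM[symmetric, OF fin]) (auto simp: product_sigma_finite_def n.sigma_finite_measure_axioms)
  also have "\<dots> = density (Pi\<^sub>M I (\<lambda>_. lborel)) (\<lambda>c. ennreal (gauss s (card I) (from_coords e I c)))"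
    by (simp add: gauss_from_coords[OF on] prod_ennreal)
  finally show ?thesis
    by (simp add: density_distr)
qed

text \<open>Independence makes the law of the coordinate vector the product of the marginals; since
  \<open>e\<close> spans the space, assembling the vector carries product Lebesgue measure to
  \<open>lborel\<close>.\<close>

lemma iid_normal_distr:
  fixes Y :: "'w \<Rightarrow> 'a::euclidean_space" and e :: "'i::finite \<Rightarrow> 'a"
  assumes "prob_space M" and iid: "iid_normal M s W" and s: "s > 0"
    and on: "orthonormal_family e UNIV" and sp: "span (range e) = UNIV"
    and Y: "Y = (\<lambda>\<omega>. from_coords e UNIV (\<lambda>i. W i \<omega>))"
  shows "distributed M lborel Y (gauss s DIM('a))"
proof -
  interpret prob_space M by fact
  have W: "distributed M lborel (W i) (normal_density 0 s)" for i
    using iid by (simp add: iid_normal_def)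
  have rv [measurable]: "W i \<in> borel_measurable M" for i
    using distributed_measurable[OF W[of i]] by simp
  have dW: "distr M borel (W i) = density lborel (normal_density 0 s)" for i
    using distributed_distr_eq_density[OF W[of i]] by (metis distr_cong sets_lborel)
  have card: "CARD('i) = DIM('a)"
    using orthonormal_family_card_span[OF on] unfolding sp by simp
  have "distr M borel Y
      = distr (distr M (Pi\<^sub>M UNIV (\<lambda>_. borel)) (\<lambda>\<omega>. \<lambda>i\<in>UNIV. W i \<omega>)) borel (from_coords e UNIV)"
    by (subst distr_distr) (auto simp: Y comp_def from_coords_def)
  also have "distr M (Pi\<^sub>M UNIV (\<lambda>_. borel)) (\<lambda>\<omega>. \<lambda>i\<in>UNIV. W i \<omega>)
      = Pi\<^sub>M UNIV (\<lambda>i. distr M borel (W i))"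
    using iid by (subst indep_vars_iff_distr_eq_PiM[symmetric]) (auto simp: iid_normal_def)
  also have "\<dots> = Pi\<^sub>M UNIV (\<lambda>_. density lborel (normal_density 0 s))"
    by (simp add: dW)
  also have "distr \<dots> borel (from_coords e UNIV) = density lborel (gauss s DIM('a))"
    by (simp add: distr_gaussian_from_coords[OF on s] lborel_eq_orthonormal[OF on sp] card)
  finally have "distr M lborel Y = density lborel (gauss s DIM('a))"
    by (metis distr_cong sets_lborel)
  moreover have "Y \<in> borel_measurable M"
    unfolding Y from_coords_def by measurable
  ultimately show ?thesis
    by (simp add: distributed_def)
qed

lemma iid_normal_norm_square_integrable:
  fixes e :: "'i::finite \<Rightarrow> 'a::euclidean_space"
  assumes "prob_space M" and iid: "iid_normal M s W" and s: "s > 0"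
    and on: "orthonormal_family e UNIV"
    and Y: "Y = (\<lambda>\<omega>. from_coords e UNIV (\<lambda>i. W i \<omega>))"
  shows "integrable M (\<lambda>\<omega>. (norm (Y \<omega>))\<^sup>2)"
proof -
  have "integrable M (\<lambda>\<omega>. (W i \<omega>)\<^sup>2)" for i
  proof -
    have "distributed M lborel (W i) (normal_density 0 s)"
      using iid by (simp add: iid_normal_def)
    then show ?thesis
      using integrable_normal_moment[OF s, of 0 2]
      by (subst distributed_integrable[symmetric, of M lborel "W i" "normal_density 0 s" "\<lambda>x. x\<^sup>2"]) auto
  qed
  then show ?thesis
    by (simp add: Y norm_from_coords[OF on])
qed

section \<open>Lebesgue measure on a subspace and projected Gaussians\<close>

text \<open>Resolves the choice in \<open>lborel_on\<close>, so that volume arguments can work with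
  an explicit orthonormal basis. Finiteness of \<open>B\<close> follows from independence, as unit
  vectors are nonzero.\<close>

lemma lborel_on_orthonormal:
  fixes S :: "'a::euclidean_space set"
  assumes "subspace S"
  obtains B where "orthonormal_family (\<lambda>b. b) B" "span B = S"
    "lborel_on S = distr (Pi\<^sub>M B (\<lambda>_. lborel)) borel (from_coords (\<lambda>b. b) B)"
proof -
  let ?P = "\<lambda>B. pairwise orthogonal B \<and> (\<forall>b\<in>B. norm b = 1) \<and> span B = S"
  define B where "B = (SOME B. ?P B)"
  have "\<exists>B. ?P B" using orthonormal_basis_subspace[OF assms] by metis
  then have B: "?P B" unfolding B_def by (rule someI_ex)
  have "0 \<notin> B" using B by force
  then have "finite B"
    using B pairwise_orthogonal_independent independent_imp_finite by blast
  then have "orthonormal_family (\<lambda>b. b) B"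
    using B unfolding orthonormal_family_def pairwise_def orthogonal_def norm_eq_1 by auto
  moreover have "lborel_on S = distr (Pi\<^sub>M B (\<lambda>_. lborel)) borel (from_coords (\<lambda>b. b) B)"
    unfolding lborel_on_def Let_def B_def[symmetric] from_coords_def[abs_def] ..
  ultimately show ?thesis using B that by blast
qed

lemma sets_lborel_on [simp, measurable_cong]: "sets (lborel_on S) = sets borel"
  by (simp add: lborel_on_def Let_def)

lemma space_lborel_on [simp]: "space (lborel_on S) = UNIV"
  by (simp add: lborel_on_def Let_def)

text \<open>Images of sigma-finite measures need not be sigma-finite. Here balls of integer radius
  cover the space, and in coordinates each of them lies in a cube of finite volume.\<close>

lemma sigma_finite_lborel_on:
  fixes S :: "'a::euclidean_space set"
  assumes "subspace S"
  shows "sigma_finite_measure (lborel_on S)"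
proof -
  obtain B where on: "orthonormal_family (\<lambda>b. b) B"
    and L: "lborel_on S = distr (Pi\<^sub>M B (\<lambda>_. lborel)) borel (from_coords (\<lambda>b. b) B)"
    using lborel_on_orthonormal[OF assms] by blast
  let ?P = "Pi\<^sub>M B (\<lambda>_. lborel :: real measure)"
  have fin: "finite B" using on by (simp add: orthonormal_family_def)
  have fin_ball: "emeasure (lborel_on S) (cball 0 (real n)) \<noteq> \<infinity>" for n
  proof -
    let ?Box = "Pi\<^sub>E B (\<lambda>_. {- real n..real n})"
    have "from_coords (\<lambda>b. b) B -` cball 0 (real n) \<inter> space ?P \<subseteq> ?Box"
    proof
      fix c assume c: "c \<in> from_coords (\<lambda>b. b) B -` cball 0 (real n) \<inter> space ?P"
      \<comment> \<open>A coordinate is the inner product with a unit vector, so Cauchy-Schwarz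
        bounds it by the norm.\<close>
      have "\<bar>c b\<bar> \<le> real n" if b: "b \<in> B" for b
      proof -
        have "norm b = 1" using orthonormal_family_inner[OF on b b] by (simp add: norm_eq_1)
        then have "\<bar>c b\<bar> \<le> norm (from_coords (\<lambda>b. b) B c)"
          using Cauchy_Schwarz_ineq2[of "from_coords (\<lambda>b. b) B c" b] inner_from_coords[OF on b, of c]
          by simp
        also have "\<dots> \<le> real n" using c by simp
        finally show ?thesis .
      qed
      then show "c \<in> ?Box" using c by (auto simp: space_PiM PiE_iff abs_le_iff minus_le_iff)
    qed
    then have "emeasure (lborel_on S) (cball 0 (real n)) \<le> emeasure ?P ?Box"
      unfolding L using fin
      by (subst emeasure_distr) (auto intro!: emeasure_mono sets_PiM_I_finite)
    also have "\<dots> = (\<Prod>b\<in>B. emeasure lborel {- real n..real n})"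
      using fin by (intro lborel_prod.emeasure_PiM) auto
    also have "\<dots> < \<infinity>"
      by (simp add: prod_ennreal emeasure_lborel_Icc_eq del: prod_constant)
    finally show ?thesis by simp
  qed
  show ?thesis
  proof
    show "\<exists>A. countable A \<and> A \<subseteq> sets (lborel_on S) \<and> \<Union>A = space (lborel_on S) \<and> (\<forall>a\<in>A. emeasure (lborel_on S) a \<noteq> \<infinity>)"
      by (rule exI[of _ "range (\<lambda>n. cball 0 (real n))"])
        (use fin_ball real_arch_simple in \<open>auto simp: subset_eq\<close>)
  qed
qed

text \<open>The hypotheses on \<open>p\<close> describe the orthogonal projection onto
  \<open>S\<close>. In an orthonormal basis of \<open>S\<close> extended by one of its orthogonal
  complement, \<open>p\<close> forgets the complementary coordinates, and what remains is the
  Gaussian product over the basis of \<open>S\<close>.\<close>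

lemma distr_gaussian_projection:
  fixes S :: "'a::euclidean_space set"
  assumes S: "subspace S" and s: "s > 0" and [measurable]: "p \<in> borel_measurable borel"
    and pS: "\<And>x. p x \<in> S" and porth: "\<And>x y. y \<in> S \<Longrightarrow> (x - p x) \<bullet> y = 0"
  shows "distr (density lborel (gauss s DIM('a))) borel p = density (lborel_on S) (gauss s (dim S))"
proof -
  obtain B where on: "orthonormal_family (\<lambda>b. b) B" and spB: "span B = S"
    and L: "lborel_on S = distr (Pi\<^sub>M B (\<lambda>_. lborel)) borel (from_coords (\<lambda>b. b) B)"
    using lborel_on_orthonormal[OF S] by blast
  define S' where "S' = {x. \<forall>y\<in>S. x \<bullet> y = 0}"
  have S': "subspace S'"
    unfolding subspace_def S'_def by (simp add: inner_add_left)
  obtain B' where on': "orthonormal_family (\<lambda>b. b) B'" and spB': "span B' = S'"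
    using lborel_on_orthonormal[OF S'] by blast
  have cross: "b \<bullet> b' = 0 \<and> b' \<bullet> b = 0" if "b \<in> B" "b' \<in> B'" for b b'
  proof -
    have "b \<in> S" using that spB span_base by blast
    moreover have "b' \<in> S'" using that spB' span_base by blast
    ultimately have "b' \<bullet> b = 0" by (simp add: S'_def)
    then show ?thesis by (simp add: inner_commute)
  qed
  have disj: "B \<inter> B' = {}"
  proof (rule equals0I)
    fix b assume "b \<in> B \<inter> B'"
    then show False using cross[of b b] orthonormal_family_inner[OF on, of b b] by simp
  qed
  define K where "K = B \<union> B'"
  have finK: "finite K" using on on' by (simp add: orthonormal_family_def K_def)
  have onK: "orthonormal_family (\<lambda>b. b) K"
    unfolding orthonormal_family_def
  proof (intro conjI ballI finK)
    fix i j assume "i \<in> K" "j \<in> K"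
    then consider "i \<in> B" "j \<in> B" | "i \<in> B'" "j \<in> B'" | "i \<in> B" "j \<in> B'" | "i \<in> B'" "j \<in> B"
      unfolding K_def by blast
    then show "i \<bullet> j = (if i = j then 1 else 0)"
    proof cases
      case 1 then show ?thesis by (rule orthonormal_family_inner[OF on])
    next
      case 2 then show ?thesis by (rule orthonormal_family_inner[OF on'])
    next
      case 3
      then have "i \<noteq> j" using disj by blast
      then show ?thesis using cross[OF 3] by simp
    next
      case 4
      then have "i \<noteq> j" using disj by blast
      then show ?thesis using cross[OF 4(2,1)] by simp
    qed
  qed
  \<comment> \<open>The decomposition \<open>x = p x + (x - p x)\<close> has its first summand in
    \<open>S\<close> and its second in the complement.\<close>
  have spK: "span ((\<lambda>b. b) ` K) = UNIV"
  proof -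
    have "x \<in> span K" for x
    proof -
      have "p x \<in> span K" using pS[of x] span_mono[of B K] unfolding K_def spB by blast
      moreover have "x - p x \<in> span K"
        proof -
        have "x - p x \<in> span B'" unfolding spB' S'_def using porth by blast
        then show ?thesis using span_mono[of B' K] by (auto simp: K_def)
      qed
      ultimately have "p x + (x - p x) \<in> span K" by (rule span_add)
      then show ?thesis by simp
    qed
    then show ?thesis by auto
  qed
  have cardK: "card K = DIM('a)"
    using orthonormal_family_card_span[OF onK] unfolding spK by simp
  have cardB: "card B = dim S"
    using orthonormal_family_card_span[OF on] spB by simp
  have p_coords: "p (from_coords (\<lambda>b. b) K c) = from_coords (\<lambda>b. b) B (restrict c B)" for c
  proof -
    let ?z = "from_coords (\<lambda>b. b) K c" and ?y = "from_coords (\<lambda>b. b) B c"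
      and ?y' = "from_coords (\<lambda>b. b) B' c"
    have z: "?z = ?y + ?y'"
      unfolding from_coords_def K_def
      using finK disj by (intro sum.union_disjoint) (auto simp: K_def)
    have y: "?y \<in> S"
      unfolding from_coords_def spB[symmetric] by (intro span_sum span_scale span_base)
    have y': "?y' \<in> S'"
      unfolding from_coords_def spB'[symmetric] by (intro span_sum span_scale span_base)
    have d: "p ?z - ?y \<in> S" using pS y S by (simp add: subspace_diff)
    \<comment> \<open>The difference \<open>p ?z - ?y\<close> lies in \<open>S\<close> and equals
      \<open>?y' - (?z - p ?z)\<close>, where both terms are orthogonal to \<open>S\<close>; hence
      it is orthogonal to itself.\<close>
    have "(p ?z - ?y) \<bullet> (p ?z - ?y) = ?y' \<bullet> (p ?z - ?y) - (?z - p ?z) \<bullet> (p ?z - ?y)"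
      unfolding z by (simp add: inner_diff_left inner_add_left)
    also have "\<dots> = 0" using porth[OF d] y' d by (simp add: S'_def)
    finally show ?thesis by simp
  qed
  interpret n: prob_space "density lborel (normal_density 0 s)"
    using s by (rule prob_space_normal_density)
  interpret n: product_prob_space "\<lambda>_. density lborel (normal_density 0 s)" UNIV
    by unfold_locales
  let ?N = "\<lambda>I. Pi\<^sub>M I (\<lambda>_. density lborel (normal_density 0 s))"
  have "density lborel (gauss s DIM('a)) = distr (?N K) borel (from_coords (\<lambda>b. b) K)"
    by (simp add: distr_gaussian_from_coords[OF onK s] lborel_eq_orthonormal[OF onK spK] cardK)
  then have "distr (density lborel (gauss s DIM('a))) borel p
      = distr (?N K) borel (\<lambda>c. from_coords (\<lambda>b. b) B (restrict c B))"
    by (simp add: distr_distr comp_def p_coords del: from_coords_restrict)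
  also have "\<dots> = distr (distr (?N K) (?N B) (\<lambda>c. restrict c B)) borel (from_coords (\<lambda>b. b) B)"
    by (subst distr_distr) (auto simp: comp_def K_def intro!: measurable_restrict_subset)
  \<comment> \<open>The forgotten factors are probability measures, so integrating them out
    contributes 1.\<close>
  also have "distr (?N K) (?N B) (\<lambda>c. restrict c B) = ?N B"
    using finK by (intro n.distr_restrict[symmetric]) (auto simp: K_def)
  finally show ?thesis
    by (simp add: distr_gaussian_from_coords[OF on s] L cardB)
qed

section \<open>Additive noise channels\<close>

text \<open>Independence of the generated sigma-algebras gives the product formula on rectangles,
  which determine the joint law. The pair is swapped because the observation, and with it the noise,
  is the first component below.\<close>

lemma (in prob_space) indep_random_vars_distr_pair:
  assumes "indep_random_vars M S X T Y"
  shows "distr M (T \<Otimes>\<^sub>M S) (\<lambda>\<omega>. (Y \<omega>, X \<omega>)) = distr M T Y \<Otimes>\<^sub>M distr M S X"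
proof -
  have X [measurable]: "X \<in> measurable M S" and Y [measurable]: "Y \<in> measurable M T"
    and indep: "indep_set (sets (vimage_algebra (space M) X S)) (sets (vimage_algebra (space M) Y T))"
    using assms by (simp_all add: indep_random_vars_def)
  interpret X: prob_space "distr M S X" by (rule prob_space_distr) fact
  interpret Y: prob_space "distr M T Y" by (rule prob_space_distr) fact
  show ?thesis
  proof (rule pair_measure_eqI[symmetric])
    fix A B assume A: "A \<in> sets (distr M T Y)" and B: "B \<in> sets (distr M S X)"
    then have [measurable]: "A \<in> sets T" "B \<in> sets S" by auto
    have "(\<lambda>\<omega>. (Y \<omega>, X \<omega>)) -` (A \<times> B) \<inter> space M = (X -` B \<inter> space M) \<inter> (Y -` A \<inter> space M)"
      by auto
    moreover have "prob \<dots> = prob (X -` B \<inter> space M) * prob (Y -` A \<inter> space M)"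
      by (rule indep_setD[OF indep]) (auto intro: in_vimage_algebra)
    ultimately show "emeasure (distr M T Y) A * emeasure (distr M S X) B
        = emeasure (distr M (T \<Otimes>\<^sub>M S) (\<lambda>\<omega>. (Y \<omega>, X \<omega>))) (A \<times> B)"
      by (simp add: emeasure_distr emeasure_eq_measure ennreal_mult[symmetric] mult.commute)
  qed (simp_all add: X.sigma_finite_measure_axioms Y.sigma_finite_measure_axioms)
qed

text \<open>Given \<open>X = x\<close> the observation is the noise translated by \<open>L x\<close>.\<close>

lemma (in prob_space) distributed_additive_noise:
  fixes X :: "'a \<Rightarrow> 'b::euclidean_space" and E :: "'a \<Rightarrow> 'c::euclidean_space"
    and f :: "'b \<Rightarrow> real" and g :: "'c \<Rightarrow> real"
  assumes \<mu>: "sigma_finite_measure \<mu>" and sets_\<mu> [measurable_cong]: "sets \<mu> = sets borel"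
    and X: "distributed M \<mu> X f" and E: "distributed M lborel E g"
    and [measurable]: "f \<in> borel_measurable borel" "g \<in> borel_measurable borel"
    and f0: "\<And>x. f x \<ge> 0"
    and indep: "indep_random_vars M borel X borel E"
    and L [measurable]: "L \<in> borel \<rightarrow>\<^sub>M borel"
  shows "distributed M (lborel \<Otimes>\<^sub>M \<mu>) (\<lambda>\<omega>. (L (X \<omega>) + E \<omega>, X \<omega>)) (\<lambda>(y, x). g (y - L x) * f x)"
proof -
  have [measurable]: "X \<in> borel_measurable M" "E \<in> borel_measurable M"
    using indep by (simp_all add: indep_random_vars_def)
  interpret \<mu>: sigma_finite_measure \<mu> by fact
  interpret pair_sigma_finite "lborel :: 'c measure" \<mu> ..
  have dX: "distr M borel X = density \<mu> f"
    using distributed_distr_eq_density[OF X] by (metis distr_cong sets_\<mu>)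
  have dE: "distr M borel E = density lborel g"
    using distributed_distr_eq_density[OF E] by (metis distr_cong sets_lborel)
  interpret X: prob_space "density \<mu> f"
    unfolding dX[symmetric] by (rule prob_space_distr) simp
  interpret E: prob_space "density lborel g"
    unfolding dE[symmetric] by (rule prob_space_distr) simp
  interpret XE: pair_sigma_finite "density lborel g" "density \<mu> f" ..
  have law: "distr M (borel \<Otimes>\<^sub>M borel) (\<lambda>\<omega>. (E \<omega>, X \<omega>)) = density lborel g \<Otimes>\<^sub>M density \<mu> f"
    using indep_random_vars_distr_pair[OF indep] by (simp add: dX dE)
  have "distr M (lborel \<Otimes>\<^sub>M \<mu>) (\<lambda>\<omega>. (L (X \<omega>) + E \<omega>, X \<omega>))
      = density (lborel \<Otimes>\<^sub>M \<mu>) (\<lambda>(y, x). g (y - L x) * f x)"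
  proof (rule measure_eqI)
    fix A assume "A \<in> sets (distr M (lborel \<Otimes>\<^sub>M \<mu>) (\<lambda>\<omega>. (L (X \<omega>) + E \<omega>, X \<omega>)))"
    then have A [measurable]: "A \<in> sets (borel \<Otimes>\<^sub>M borel)"
      by (simp cong: sets_pair_measure_cong add: sets_\<mu>)
    let ?i = "indicator A :: _ \<Rightarrow> ennreal"
    have "emeasure (distr M (lborel \<Otimes>\<^sub>M \<mu>) (\<lambda>\<omega>. (L (X \<omega>) + E \<omega>, X \<omega>))) A
        = (\<integral>\<^sup>+\<omega>. ?i (L (X \<omega>) + E \<omega>, X \<omega>) \<partial>M)"
      by (subst nn_integral_indicator[symmetric], simp cong: sets_pair_measure_cong add: sets_\<mu> A,
          subst nn_integral_distr) simp_all
    also have "\<dots> = (\<integral>\<^sup>+z. ?i (L (snd z) + fst z, snd z) \<partial>distr M (borel \<Otimes>\<^sub>M borel) (\<lambda>\<omega>. (E \<omega>, X \<omega>)))"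
      by (subst nn_integral_distr) simp_all
    \<comment> \<open>With the noise innermost, \<open>x\<close> is fixed and the substitution
      \<open>y = L x + e\<close> is a translation, under which \<open>lborel\<close> is
      invariant.\<close>
    also have "\<dots> = (\<integral>\<^sup>+x. \<integral>\<^sup>+e. ?i (L x + e, x) \<partial>density lborel g \<partial>density \<mu> f)"
      unfolding law by (subst XE.nn_integral_snd[symmetric]) simp_all
    also have "\<dots> = (\<integral>\<^sup>+x. f x * (\<integral>\<^sup>+e. g e * ?i (L x + e, x) \<partial>lborel) \<partial>\<mu>)"
      by (simp add: nn_integral_density)
    also have "\<dots> = (\<integral>\<^sup>+x. f x * (\<integral>\<^sup>+y. g (y - L x) * ?i (y, x) \<partial>lborel) \<partial>\<mu>)"
    proof (rule nn_integral_cong)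
      fix x assume "x \<in> space \<mu>"
      have "(\<integral>\<^sup>+y. g (y - L x) * ?i (y, x) \<partial>lborel) = (\<integral>\<^sup>+e. g e * ?i (L x + e, x) \<partial>lborel)"
        by (subst lborel_distr_plus[of "L x", symmetric]) (simp add: nn_integral_distr)
      then show "f x * (\<integral>\<^sup>+e. g e * ?i (L x + e, x) \<partial>lborel)
          = f x * (\<integral>\<^sup>+y. g (y - L x) * ?i (y, x) \<partial>lborel)" by simp
    qed
    also have "\<dots> = (\<integral>\<^sup>+x. \<integral>\<^sup>+y. f x * (g (y - L x) * ?i (y, x)) \<partial>lborel \<partial>\<mu>)"
      by (simp add: nn_integral_cmult)
    also have "\<dots> = (\<integral>\<^sup>+z. f (snd z) * (g (fst z - L (snd z)) * ?i z) \<partial>(lborel \<Otimes>\<^sub>M \<mu>))"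
      by (subst nn_integral_snd[symmetric]) simp_all
    also have "\<dots> = emeasure (density (lborel \<Otimes>\<^sub>M \<mu>) (\<lambda>(y, x). g (y - L x) * f x)) A"
      by (subst emeasure_density)
        (auto simp: split_beta' ennreal_mult' f0 mult_ac intro!: nn_integral_cong
          cong: sets_pair_measure_cong)
    finally show "emeasure (distr M (lborel \<Otimes>\<^sub>M \<mu>) (\<lambda>\<omega>. (L (X \<omega>) + E \<omega>, X \<omega>))) A
      = emeasure (density (lborel \<Otimes>\<^sub>M \<mu>) (\<lambda>(y, x). g (y - L x) * f x)) A" .
  qed simp
  then show ?thesis
    by (auto simp: distributed_def split_beta')
qed

text \<open>Entropies relative to different reference measures become expectations over the one
  space \<open>M\<close>, where they can be compared and added.\<close>

lemma (in information_space) entropy_eq_expectation: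
  assumes X: "distributed M S X f" and nn: "\<And>x. x \<in> space S \<Longrightarrow> 0 \<le> f x"
  shows "entropy b S X = - expectation (\<lambda>\<omega>. log b (f (X \<omega>)))"
proof -
  have [measurable]: "f \<in> borel_measurable S"
    by (rule distributed_real_measurable[OF nn X])
  have "entropy b S X = - (\<integral>x. f x * log b (f x) \<partial>S)"
    by (rule entropy_distr[OF X nn])
  also have "(\<integral>x. f x * log b (f x) \<partial>S) = expectation (\<lambda>\<omega>. log b (f (X \<omega>)))"
    by (rule distributed_integral[OF X _ nn]) measurable
  finally show ?thesis .
qed

text \<open>Strict positivity of \<open>f\<close> and \<open>g\<close> lets the logarithm of the
  joint density split at every sample point. The bound \<open>c\<close> keeps the density of the
  observation finite; \<open>intY\<close> concerns the logarithm of that density.\<close>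

lemma (in information_space) additive_noise_chain_rule:
  fixes X :: "'a \<Rightarrow> 'b::euclidean_space" and E :: "'a \<Rightarrow> 'c::euclidean_space"
    and f :: "'b \<Rightarrow> real" and g :: "'c \<Rightarrow> real"
  assumes \<mu>: "sigma_finite_measure \<mu>" and sets_\<mu> [measurable_cong]: "sets \<mu> = sets borel"
    and X: "distributed M \<mu> X f" and E: "distributed M lborel E g"
    and [measurable]: "f \<in> borel_measurable borel" "g \<in> borel_measurable borel"
    and f0: "\<And>x. f x > 0" and g0: "\<And>y. g y > 0" and g_le: "\<And>y. g y \<le> c"
    and indep: "indep_random_vars M borel X borel E"
    and L [measurable]: "L \<in> borel \<rightarrow>\<^sub>M borel"
    and intX: "integrable M (\<lambda>\<omega>. log b (f (X \<omega>)))"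
    and intE: "integrable M (\<lambda>\<omega>. log b (g (E \<omega>)))"
  defines "Y \<equiv> \<lambda>\<omega>. L (X \<omega>) + E \<omega>"
  assumes intY: "integrable M (\<lambda>\<omega>. log b (\<integral>\<omega>'. g (Y \<omega> - L (X \<omega>')) \<partial>M))"
  shows "entropy b (lborel \<Otimes>\<^sub>M \<mu>) (\<lambda>\<omega>. (Y \<omega>, X \<omega>)) = entropy b \<mu> X + entropy b lborel E"
    and "entropy b lborel Y + conditional_entropy b \<mu> lborel X Y
      = entropy b (lborel \<Otimes>\<^sub>M \<mu>) (\<lambda>\<omega>. (Y \<omega>, X \<omega>))"
proof -
  have [measurable]: "X \<in> borel_measurable M" "E \<in> borel_measurable M"
    using indep by (simp_all add: indep_random_vars_def)
  define p where "p = (\<lambda>(y, x). g (y - L x) * f x)"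
  define q where "q = (\<lambda>y. \<integral>\<omega>. g (y - L (X \<omega>)) \<partial>M)"
  have p0: "p z > 0" for z using f0 g0 by (simp add: p_def split_beta')
  have q0: "q y \<ge> 0" for y unfolding q_def using g0 by (intro Bochner_Integration.integral_nonneg) (simp add: less_imp_le)
  have q_meas [measurable]: "q \<in> borel_measurable borel" unfolding q_def by measurable
  have dYX: "distributed M (lborel \<Otimes>\<^sub>M \<mu>) (\<lambda>\<omega>. (Y \<omega>, X \<omega>)) p"
    unfolding Y_def p_def using f0
    by (intro distributed_additive_noise[OF \<mu> sets_\<mu> X E _ _ _ indep L]) (auto intro: less_imp_le)
  have dXY: "distributed M (\<mu> \<Otimes>\<^sub>M lborel) (\<lambda>\<omega>. (X \<omega>, Y \<omega>)) (\<lambda>(x, y). p (y, x))"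
    using distributed_swap[OF lborel.sigma_finite_measure_axioms \<mu> dYX] by (simp add: split_beta')
  \<comment> \<open>Integrating the joint density over \<open>x\<close> averages the translated
    noise density over the law of \<open>X\<close>.\<close>
  have dY: "distributed M lborel Y q"
  proof -
    have "(\<integral>\<^sup>+x. p (y, x) \<partial>\<mu>) = ennreal (q y)" for y
    proof -
      have "(\<integral>\<^sup>+x. p (y, x) \<partial>\<mu>) = (\<integral>\<^sup>+x. f x * ennreal (g (y - L x)) \<partial>\<mu>)"
        unfolding p_def using f0 g0 by (simp add: ennreal_mult less_imp_le mult.commute)
      also have "\<dots> = (\<integral>\<^sup>+\<omega>. g (y - L (X \<omega>)) \<partial>M)"
        by (rule distributed_nn_integral[OF X]) measurable
      also have "\<dots> = ennreal (q y)"
        unfolding q_def using g0 g_le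
        by (intro nn_integral_eq_integral integrable_const_bound[where B=c])
          (auto simp: less_imp_le abs_of_pos)
      finally show ?thesis .
    qed
    then show ?thesis
      using distr_marginal1[OF lborel.sigma_finite_measure_axioms \<mu> dYX] by simp
  qed
  \<comment> \<open>Since \<open>Y - L X\<close> is the noise, \<open>L\<close> cancels here; this
    is why the joint entropy does not see it.\<close>
  have log_p: "log b (p (Y \<omega>, X \<omega>)) = log b (g (E \<omega>)) + log b (f (X \<omega>))" for \<omega>
    using f0[of "X \<omega>"] g0[of "E \<omega>"] by (simp add: p_def Y_def log_mult)
  have HYX: "entropy b (lborel \<Otimes>\<^sub>M \<mu>) (\<lambda>\<omega>. (Y \<omega>, X \<omega>)) = - expectation (\<lambda>\<omega>. log b (p (Y \<omega>, X \<omega>)))"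
    using p0 by (intro entropy_eq_expectation[OF dYX]) (simp add: less_imp_le)
  \<comment> \<open>The conditional entropy of \<open>X\<close> given \<open>Y\<close> works with
    the pair in the order \<open>(X, Y)\<close>. Both orders give the same expectation, so the two
    joint entropies coincide.\<close>
  have HXY: "entropy b (\<mu> \<Otimes>\<^sub>M lborel) (\<lambda>\<omega>. (X \<omega>, Y \<omega>)) = - expectation (\<lambda>\<omega>. log b (p (Y \<omega>, X \<omega>)))"
    using p0 by (subst entropy_eq_expectation[OF dXY]) (auto simp add: less_imp_le)
  show "entropy b (lborel \<Otimes>\<^sub>M \<mu>) (\<lambda>\<omega>. (Y \<omega>, X \<omega>)) = entropy b \<mu> X + entropy b lborel E"
    using f0 g0 intX intE
    by (simp add: HYX log_p entropy_eq_expectation[OF X] entropy_eq_expectation[OF E] less_imp_le)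
  have p_meas [measurable]: "p \<in> borel_measurable (borel \<Otimes>\<^sub>M borel)"
    unfolding p_def by measurable
  \<comment> \<open>This and the next fact are the integrability conditions for writing conditional
    entropy as a difference of entropies. Pulled back to \<open>M\<close> they are
    \<open>intX\<close> with \<open>intE\<close>, and \<open>intY\<close>.\<close>
  have "integrable (\<mu> \<Otimes>\<^sub>M lborel) (\<lambda>z. (case z of (x, y) \<Rightarrow> p (y, x)) * log b (case z of (x, y) \<Rightarrow> p (y, x)))"
    using intX intE p0
    by (subst distributed_integrable[OF dXY]) (auto simp: log_p less_imp_le split_beta')
  moreover have "integrable (\<mu> \<Otimes>\<^sub>M lborel) (\<lambda>z. (case z of (x, y) \<Rightarrow> p (y, x)) * log b (q (snd z)))"
    using intY p0
    by (subst distributed_integrable[OF dXY]) (auto simp: less_imp_le split_beta' q_def)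
  ultimately have "conditional_entropy b \<mu> lborel X Y
      = entropy b (\<mu> \<Otimes>\<^sub>M lborel) (\<lambda>\<omega>. (X \<omega>, Y \<omega>)) - entropy b lborel Y"
    using p0 q0
    by (intro conditional_entropy_eq_entropy[OF \<mu> lborel.sigma_finite_measure_axioms dY _ dXY])
      (auto simp: less_imp_le)
  then show "entropy b lborel Y + conditional_entropy b \<mu> lborel X Y
      = entropy b (lborel \<Otimes>\<^sub>M \<mu>) (\<lambda>\<omega>. (Y \<omega>, X \<omega>))"
    by (simp add: HYX HXY)
qed

section \<open>Second moments and the Gaussian channel\<close>

lemma norm_add_square_le:
  fixes a b :: "'a::real_normed_vector"
  shows "(norm (a + b))\<^sup>2 \<le> 2 * (norm a)\<^sup>2 + 2 * (norm b)\<^sup>2"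
proof -
  have "(norm (a + b))\<^sup>2 \<le> (norm a + norm b)\<^sup>2"
    by (intro power_mono norm_triangle_ineq) simp
  also have "\<dots> \<le> 2 * (norm a)\<^sup>2 + 2 * (norm b)\<^sup>2"
    using sum_squares_bound[of "norm a" "norm b"] by (simp add: power2_sum)
  finally show ?thesis .
qed

lemma integrable_norm_square_add:
  fixes V W :: "'a \<Rightarrow> 'b::euclidean_space"
  assumes [measurable]: "V \<in> borel_measurable M" "W \<in> borel_measurable M"
    and "integrable M (\<lambda>\<omega>. (norm (V \<omega>))\<^sup>2)" "integrable M (\<lambda>\<omega>. (norm (W \<omega>))\<^sup>2)"
  shows "integrable M (\<lambda>\<omega>. (norm (V \<omega> + W \<omega>))\<^sup>2)"
proof (rule Bochner_Integration.integrable_bound)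
  show "integrable M (\<lambda>\<omega>. 2 * (norm (V \<omega>))\<^sup>2 + 2 * (norm (W \<omega>))\<^sup>2)"
    using assms by simp
  show "AE \<omega> in M. norm ((norm (V \<omega> + W \<omega>))\<^sup>2) \<le> norm (2 * (norm (V \<omega>))\<^sup>2 + 2 * (norm (W \<omega>))\<^sup>2)"
    using norm_add_square_le by (intro AE_I2) (simp add: abs_of_nonneg)
qed simp

text \<open>The peak \<open>c\<close> of the Gaussian bounds the mixture from above, and Jensen's
  inequality bounds it from below by \<open>c * exp (- K)\<close>. The bound is quadratic in
  \<open>y\<close>, so it is integrable for observations with second moments.\<close>

lemma (in prob_space) ln_gauss_mixture_bound:
  fixes V :: "'a \<Rightarrow> 'b::euclidean_space"
  assumes s: "s > 0" and [measurable]: "V \<in> borel_measurable M"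
    and V2: "integrable M (\<lambda>\<omega>. (norm (V \<omega>))\<^sup>2)"
  shows "\<bar>ln (expectation (\<lambda>\<omega>. gauss s k (y - V \<omega>)))\<bar>
    \<le> \<bar>ln ((1 / sqrt (2 * pi * s\<^sup>2)) ^ k)\<bar> + ((norm y)\<^sup>2 + expectation (\<lambda>\<omega>. (norm (V \<omega>))\<^sup>2)) / s\<^sup>2"
proof -
  define c where "c = (1 / sqrt (2 * pi * s\<^sup>2)) ^ k"
  define K where "K = ((norm y)\<^sup>2 + expectation (\<lambda>\<omega>. (norm (V \<omega>))\<^sup>2)) / s\<^sup>2"
  define t where "t = (\<lambda>\<omega>. - (norm (y - V \<omega>))\<^sup>2 / (2 * s\<^sup>2))"
  let ?q = "expectation (\<lambda>\<omega>. gauss s k (y - V \<omega>))"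
  have c: "c > 0" using s by (simp add: c_def)
  have K: "K \<ge> 0" unfolding K_def by (intro divide_nonneg_nonneg add_nonneg_nonneg) auto
  have int_diff: "integrable M (\<lambda>\<omega>. (norm (y - V \<omega>))\<^sup>2)"
    using integrable_norm_square_add[of "\<lambda>_. y" M "\<lambda>\<omega>. - V \<omega>"] V2 by simp
  have int_t: "integrable M t"
    unfolding t_def using int_diff by simp
  have int_g: "integrable M (\<lambda>\<omega>. gauss s k (y - V \<omega>))"
    using gauss_le[OF s] by (intro integrable_const_bound[where B=c]) (auto simp: c_def abs_of_nonneg)
  have upper: "?q \<le> c"
    using gauss_le[OF s] by (intro integral_le_const[OF int_g]) (auto simp: c_def)
  \<comment> \<open>Jensen by hand: the integrand on the left is the tangent line of
    \<open>exp\<close> at \<open>expectation t\<close>, scaled by \<open>c\<close>; its linear part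
    has mean zero.\<close>
  have "expectation (\<lambda>\<omega>. c * (exp (expectation t) * (1 + (t \<omega> - expectation t)))) \<le> ?q"
  proof (rule integral_mono)
    fix \<omega>
    have "exp (expectation t) * (1 + (t \<omega> - expectation t)) \<le> exp (expectation t) * exp (t \<omega> - expectation t)"
      by (intro mult_left_mono exp_ge_add_one_self) simp
    also have "\<dots> = exp (t \<omega>)" by (simp add: exp_add[symmetric])
    finally show "c * (exp (expectation t) * (1 + (t \<omega> - expectation t))) \<le> gauss s k (y - V \<omega>)"
      using c by (simp add: gauss_def t_def c_def)
  qed (use int_t int_g in auto)
  then have lower: "c * exp (expectation t) \<le> ?q"
    using int_t by (simp add: prob_space)
  \<comment> \<open>The factor 2 cancels the one in the denominator of \<open>t\<close>, which
    leaves \<open>s\<^sup>2\<close> in \<open>K\<close>.\<close>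
  have "expectation (\<lambda>\<omega>. (norm (y - V \<omega>))\<^sup>2) \<le> expectation (\<lambda>\<omega>. 2 * (norm y)\<^sup>2 + 2 * (norm (V \<omega>))\<^sup>2)"
    using norm_add_square_le[of y "- V \<omega>" for \<omega>] V2 by (intro integral_mono int_diff) auto
  also have "\<dots> = 2 * ((norm y)\<^sup>2 + expectation (\<lambda>\<omega>. (norm (V \<omega>))\<^sup>2))"
    using V2 by (simp add: prob_space)
  finally have "- K \<le> expectation t"
    using s by (simp add: t_def K_def field_simps)
  moreover have "ln c + expectation t \<le> ln ?q"
  proof -
    have "ln (c * exp (expectation t)) \<le> ln ?q"
      using lower c by (subst ln_le_cancel_iff) (auto intro: less_le_trans[OF _ lower])
    then show ?thesis using c by (simp add: ln_mult)
  qed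
  moreover have "ln ?q \<le> ln c"
    using upper c less_le_trans[OF _ lower, of 0] by (subst ln_le_cancel_iff) auto
  ultimately have "\<bar>ln ?q\<bar> \<le> \<bar>ln c\<bar> + K" using K by linarith
  then show ?thesis by (simp add: c_def K_def)
qed

text \<open>For Gaussian densities the integrability conditions of the chain rule reduce to second
  moments. The reference measure of \<open>X\<close> and the exponent \<open>k\<close> stay general
  so that \<open>X\<close> may live on a subspace.\<close>

lemma (in prob_space) gaussian_channel_entropy:
  fixes X :: "'a \<Rightarrow> 'b::euclidean_space" and E :: "'a \<Rightarrow> 'c::euclidean_space"
  assumes s: "s > 0" and h: "h > 0"
    and \<mu>: "sigma_finite_measure \<mu>" and sets_\<mu>: "sets \<mu> = sets borel"
    and X: "distributed M \<mu> X (gauss s k)" and X2: "integrable M (\<lambda>\<omega>. (norm (X \<omega>))\<^sup>2)"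
    and E: "distributed M lborel E (gauss h l)" and E2: "integrable M (\<lambda>\<omega>. (norm (E \<omega>))\<^sup>2)"
    and indep: "indep_random_vars M borel X borel E"
    and L: "bounded_linear L"
  defines "Y \<equiv> \<lambda>\<omega>. L (X \<omega>) + E \<omega>"
  shows "entropy (exp 1) (lborel \<Otimes>\<^sub>M \<mu>) (\<lambda>\<omega>. (Y \<omega>, X \<omega>))
      = entropy (exp 1) \<mu> X + entropy (exp 1) lborel E"
    and "entropy (exp 1) lborel Y + conditional_entropy (exp 1) \<mu> lborel X Y
      = entropy (exp 1) (lborel \<Otimes>\<^sub>M \<mu>) (\<lambda>\<omega>. (Y \<omega>, X \<omega>))"
proof -
  interpret information_space M "exp 1"
    by unfold_locales simp
  have [measurable]: "X \<in> borel_measurable M" "E \<in> borel_measurable M"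
    using indep by (simp_all add: indep_random_vars_def)
  have [measurable]: "L \<in> borel \<rightarrow>\<^sub>M borel"
    using L by (intro borel_measurable_continuous_onI linear_continuous_on)
  have ln_eq: "log (exp 1) x = ln x" for x :: real by (simp add: log_def)
  obtain C where C: "\<And>x. norm (L x) \<le> norm x * C" using bounded_linear.bounded[OF L] by blast
  have LX2: "integrable M (\<lambda>\<omega>. (norm (L (X \<omega>)))\<^sup>2)"
  proof (rule Bochner_Integration.integrable_bound)
    show "integrable M (\<lambda>\<omega>. C\<^sup>2 * (norm (X \<omega>))\<^sup>2)" using X2 by simp
    show "AE \<omega> in M. norm ((norm (L (X \<omega>)))\<^sup>2) \<le> norm (C\<^sup>2 * (norm (X \<omega>))\<^sup>2)"
      using power_mono[OF C norm_ge_zero, of _ 2] by (intro AE_I2) (simp add: power_mult_distrib mult.commute)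
  qed simp
  have Y2: "integrable M (\<lambda>\<omega>. (norm (Y \<omega>))\<^sup>2)"
    unfolding Y_def using LX2 E2 by (intro integrable_norm_square_add) auto
  have intX: "integrable M (\<lambda>\<omega>. log (exp 1) (gauss s k (X \<omega>)))"
    using X2 by (simp add: ln_eq ln_gauss[OF s])
  have intE: "integrable M (\<lambda>\<omega>. log (exp 1) (gauss h l (E \<omega>)))"
    using E2 by (simp add: ln_eq ln_gauss[OF h])
  have intY: "integrable M (\<lambda>\<omega>. log (exp 1) (expectation (\<lambda>\<omega>'. gauss h l (Y \<omega> - L (X \<omega>')))))"
  proof (rule Bochner_Integration.integrable_bound)
    let ?B = "\<lambda>\<omega>. \<bar>ln ((1 / sqrt (2 * pi * h\<^sup>2)) ^ l)\<bar>
      + ((norm (Y \<omega>))\<^sup>2 + expectation (\<lambda>\<omega>. (norm (L (X \<omega>)))\<^sup>2)) / h\<^sup>2"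
    show "integrable M ?B" using Y2 by simp
    show "AE \<omega> in M. norm (log (exp 1) (expectation (\<lambda>\<omega>'. gauss h l (Y \<omega> - L (X \<omega>'))))) \<le> norm (?B \<omega>)"
      using ln_gauss_mixture_bound[OF h _ LX2] by (intro AE_I2) (simp add: ln_eq order_trans[OF _ abs_ge_self])
    show "(\<lambda>\<omega>. log (exp 1) (expectation (\<lambda>\<omega>'. gauss h l (Y \<omega> - L (X \<omega>'))))) \<in> borel_measurable M"
      unfolding Y_def by measurable
  qed
  note chain = additive_noise_chain_rule[OF \<mu> sets_\<mu> X E _ _ gauss_pos[OF s] gauss_pos[OF h] gauss_le[OF h]
      indep \<open>L \<in> borel \<rightarrow>\<^sub>M borel\<close> intX intE, OF _ _ intY[unfolded Y_def]]
  show "entropy (exp 1) (lborel \<Otimes>\<^sub>M \<mu>) (\<lambda>\<omega>. (Y \<omega>, X \<omega>))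
      = entropy (exp 1) \<mu> X + entropy (exp 1) lborel E"
    unfolding Y_def by (rule chain(1)) simp_all
  show "entropy (exp 1) lborel Y + conditional_entropy (exp 1) \<mu> lborel X Y
      = entropy (exp 1) (lborel \<Otimes>\<^sub>M \<mu>) (\<lambda>\<omega>. (Y \<omega>, X \<omega>))"
    unfolding Y_def by (rule chain(2)) simp_all
qed

section \<open>Matrices\<close>

text \<open>Identifies the trace form with the Euclidean structure of the matrix type, so that
  norms, orthogonality and Gaussian laws apply to matrices directly.\<close>

lemma frobenius_inner_eq_inner: "frobenius_inner A X = A \<bullet> X"
proof -
  have "frobenius_inner A X = (\<Sum>j\<in>UNIV. \<Sum>i\<in>UNIV. A $ i $ j * X $ i $ j)"
    by (simp add: frobenius_inner_def trace_def matrix_matrix_mult_def transpose_def)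
  also have "\<dots> = (\<Sum>i\<in>UNIV. \<Sum>j\<in>UNIV. A $ i $ j * X $ i $ j)"
    by (rule sum.swap)
  finally show ?thesis by (simp add: inner_vec_def)
qed

text \<open>Testing the residual of \<open>y\<close> against \<open>P *v x\<close>, a vector of
  \<open>U\<close>, shows that \<open>(P *v x) \<bullet> y\<close> equals the symmetric expression
  \<open>(P *v x) \<bullet> (P *v y)\<close>. Self-adjointness follows, and then
  idempotence.\<close>

lemma orthogonal_projection_symmetric_idempotent:
  assumes P: "is_orthogonal_projection P U"
  shows "transpose P = P" and "P ** P = P"
proof -
  have PU: "P *v x \<in> U" and orth: "u \<in> U \<Longrightarrow> (x - P *v x) \<bullet> u = 0" for x u
    using P by (auto simp: is_orthogonal_projection_def orthogonal_def)
  have dot: "(P *v x) \<bullet> y = (P *v x) \<bullet> (P *v y)" for x y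
    using orth[OF PU[of x], of y] by (simp add: inner_diff_left inner_diff_right inner_commute)
  have sym: "(P *v x) \<bullet> y = x \<bullet> (P *v y)" for x y
    using dot[of x y] dot[of y x] by (simp add: inner_commute)
  have "transpose P *v x = P *v x" for x
  proof -
    have "(transpose P *v x) \<bullet> y = (P *v x) \<bullet> y" for y
      by (simp add: sym dot_lmul_matrix)
    then show ?thesis by (metis vector_eq_rdot)
  qed
  then show "transpose P = P" by (simp add: matrix_eq)
  have "P *v (P *v x) = P *v x" for x
  proof -
    have "(P *v (P *v x)) \<bullet> y = (P *v x) \<bullet> y" for y
      using dot[of x y] sym[of "P *v x" y] by simp
    then show ?thesis by (metis vector_eq_rdot)
  qed
  then show "P ** P = P" by (simp add: matrix_eq matrix_vector_mul_assoc[symmetric])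
qed

lemma bounded_linear_matrix_sandwich:
  fixes P :: "real^'m1^'m1" and Q :: "real^'m2^'m2"
  shows "bounded_linear (\<lambda>W :: real^'m2^'m1. P ** W ** Q)"
proof (rule linear_conv_bounded_linear[THEN iffD1], rule linearI)
  fix V W :: "real^'m2^'m1" and r :: real
  show "P ** (V + W) ** Q = P ** V ** Q + P ** W ** Q"
    by (simp add: matrix_matrix_mult_def vec_eq_iff sum.distrib algebra_simps)
  show "P ** (r *\<^sub>R V) ** Q = r *\<^sub>R (P ** V ** Q)"
    by (simp add: matrix_matrix_mult_def vec_eq_iff sum_distrib_left sum_distrib_right mult_ac)
qed

text \<open>The map \<open>W \<mapsto> P ** W ** Q\<close> is self-adjoint, by cyclicity of the
  trace, and idempotent; so its residuals are orthogonal to its range, which is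
  \<open>smg_support P Q\<close>.\<close>

lemma matrix_sandwich_orthogonal:
  fixes P :: "real^'m1^'m1" and Q :: "real^'m2^'m2" and V W :: "real^'m2^'m1"
  assumes P: "is_orthogonal_projection P U" and Q: "is_orthogonal_projection Q T"
  shows "(W - P ** W ** Q) \<bullet> (P ** V ** Q) = 0"
proof -
  note P = orthogonal_projection_symmetric_idempotent[OF P]
  note Q = orthogonal_projection_symmetric_idempotent[OF Q]
  have adj: "W \<bullet> (P ** V ** Q) = (P ** W ** Q) \<bullet> V" for V W :: "real^'m2^'m1"
  proof -
    have "W \<bullet> (P ** V ** Q) = trace ((transpose W ** P ** V) ** Q)"
      by (simp add: frobenius_inner_eq_inner[symmetric] frobenius_inner_def matrix_mul_assoc)
    also have "\<dots> = trace (Q ** (transpose W ** P ** V))"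
      by (rule trace_mul_sym)
    also have "\<dots> = (P ** W ** Q) \<bullet> V"
      by (simp add: frobenius_inner_eq_inner[symmetric] frobenius_inner_def matrix_transpose_mul
          P(1) Q(1) matrix_mul_assoc)
    finally show ?thesis .
  qed
  have "P ** (P ** W ** Q) ** Q = P ** W ** Q"
    using P(2) Q(2) by (metis matrix_mul_assoc)
  then show ?thesis unfolding inner_diff_left by (simp add: adj)
qed

lemma orthonormal_family_axis:
  "orthonormal_family (\<lambda>i. axis i 1 :: real^'n) UNIV" "span (range (\<lambda>i. axis i 1 :: real^'n)) = UNIV"
proof -
  show "orthonormal_family (\<lambda>i. axis i 1 :: real^'n) UNIV"
    by (auto simp: orthonormal_family_def inner_axis_axis)
  have "range (\<lambda>i. axis i 1 :: real^'n) = Basis" by (auto simp: Basis_vec_def)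
  then show "span (range (\<lambda>i. axis i 1 :: real^'n)) = UNIV" by simp
qed

lemma orthonormal_family_matrix_units:
  "orthonormal_family (\<lambda>(i, j). axis i (axis j 1) :: real^'m2^'m1) UNIV"
  "span (range (\<lambda>(i, j). axis i (axis j 1) :: real^'m2^'m1)) = UNIV"
proof -
  show "orthonormal_family (\<lambda>(i, j). axis i (axis j 1) :: real^'m2^'m1) UNIV"
    by (auto simp: orthonormal_family_def inner_axis_axis)
  have "range (\<lambda>(i, j). axis i (axis j 1) :: real^'m2^'m1) = Basis"
    by (auto simp: Basis_vec_def image_iff)
  then show "span (range (\<lambda>(i, j). axis i (axis j 1) :: real^'m2^'m1)) = UNIV" by simp
qed

lemma vec_eq_from_coords: "(y :: real^'n) = from_coords (\<lambda>i. axis i 1) UNIV (\<lambda>i. y $ i)"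
proof -
  have "from_coords (\<lambda>i. axis i 1) UNIV (\<lambda>i. y \<bullet> axis i 1) = y"
    using orthonormal_family_axis(2) by (intro from_coords_inner[OF orthonormal_family_axis(1)]) blast
  then show ?thesis by (simp add: inner_axis)
qed

lemma matrix_eq_from_coords:
  "(Y :: real^'m2^'m1) = from_coords (\<lambda>(i, j). axis i (axis j 1)) UNIV (\<lambda>(i, j). Y $ i $ j)"
proof -
  have "from_coords (\<lambda>(i, j). axis i (axis j 1)) UNIV (\<lambda>p. Y \<bullet> (case p of (i, j) \<Rightarrow> axis i (axis j 1))) = Y"
    using orthonormal_family_matrix_units(2)
    by (intro from_coords_inner[OF orthonormal_family_matrix_units(1)]) blast
  then show ?thesis by (simp add: inner_axis split_beta')
qed

section \<open>Entropy balance for masked observations of a projected Gaussian matrix\<close>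

theorem mainTheorem3:
  fixes M :: "'w measure" and N :: "'v measure"
    and X :: "'w \<Rightarrow> real^'m2^'m1" and noise :: "'w \<Rightarrow> real^'n"
    and Z :: "'v \<Rightarrow> real^'m2^'m1"
    and U :: "(real^'m1) set" and V :: "(real^'m2) set"
    and P :: "real^'m1^'m1" and Q :: "real^'m2^'m2"
    and R :: nat and \<sigma> \<eta> :: real
  assumes "prob_space M" and "prob_space N"
    and "\<sigma> > 0" and "\<eta> > 0"
    and "subspace U" and "dim U = R" and "subspace V" and "dim V = R"
    and "R < min CARD('m1) CARD('m2)"
    and "is_orthogonal_projection P U" and "is_orthogonal_projection Q V"
    and "iid_normal N \<sigma> (\<lambda>(i, j) \<omega>. Z \<omega> $ i $ j)"
    and "distr M borel X = distr N borel (\<lambda>\<omega>. P ** Z \<omega> ** Q)"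
    and "iid_normal M \<eta> (\<lambda>i \<omega>. noise \<omega> $ i)"
    and "indep_random_vars M borel X borel noise"
  shows
    "(\<forall>A :: 'n \<Rightarrow> real^'m2^'m1. unit_power A \<longrightarrow>
        entropy_ln M lborel (observations A X noise)
          + cond_entropy_ln M (lborel_on (smg_support P Q)) lborel X (observations A X noise)
        = joint_entropy_ln M lborel (lborel_on (smg_support P Q)) (observations A X noise) X \<and>
        joint_entropy_ln M lborel (lborel_on (smg_support P Q)) (observations A X noise) X
        = entropy_ln M (lborel_on (smg_support P Q)) X + entropy_ln M lborel noise) \<and>
     (\<forall>(A :: 'n \<Rightarrow> real^'m2^'m1) B. unit_power A \<longrightarrow> unit_power B \<longrightarrow>
        joint_entropy_ln M lborel (lborel_on (smg_support P Q)) (observations A X noise) X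
        = joint_entropy_ln M lborel (lborel_on (smg_support P Q)) (observations B X noise) X) \<and>
     (\<forall>A :: 'n \<Rightarrow> real^'m2^'m1.
        is_arg_max (\<lambda>A. entropy_ln M lborel (observations A X noise)) unit_power A \<longleftrightarrow>
        is_arg_min (\<lambda>A. cond_entropy_ln M (lborel_on (smg_support P Q)) lborel X
                          (observations A X noise)) unit_power A)"
proof -
  interpret M: prob_space M by fact
  interpret N: prob_space N by fact
  have \<sigma>: "\<sigma> > 0" and \<eta>: "\<eta> > 0"
    and P: "is_orthogonal_projection P U" and Q: "is_orthogonal_projection Q V"
    and iidZ: "iid_normal N \<sigma> (\<lambda>(i, j) \<omega>. Z \<omega> $ i $ j)"
    and distX: "distr M borel X = distr N borel (\<lambda>\<omega>. P ** Z \<omega> ** Q)"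
    and iid_noise: "iid_normal M \<eta> (\<lambda>i \<omega>. noise \<omega> $ i)"
    and indep: "indep_random_vars M borel X borel noise"
    by fact+
  define p where "p = (\<lambda>W :: real^'m2^'m1. P ** W ** Q)"
  define S where "S = smg_support P Q"
  have p: "bounded_linear p"
    unfolding p_def by (rule bounded_linear_matrix_sandwich)
  have [measurable]: "p \<in> borel \<rightarrow>\<^sub>M borel"
    using p by (intro borel_measurable_continuous_onI linear_continuous_on)
  have S_range: "S = range p"
    by (simp add: S_def p_def smg_support_def)
  have S: "subspace S"
    unfolding S_range using p by (simp add: linear_subspace_image bounded_linear.linear)
  have porth: "(W - p W) \<bullet> y = 0" if "y \<in> S" for W y
    using that matrix_sandwich_orthogonal[OF P Q] by (auto simp: S_range p_def)
  \<comment> \<open>The coordinate family is written exactly as in the hypothesis on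
    \<open>Z\<close>, with entries indexed by pairs, so that the lemmas on iid normal coordinates
    match.\<close>
  have Z_coords: "Z = (\<lambda>\<omega>. from_coords (\<lambda>(i, j). axis i (axis j 1)) UNIV (\<lambda>q. (\<lambda>(i, j) \<omega>. Z \<omega> $ i $ j) q \<omega>))"
    using matrix_eq_from_coords[of "Z \<omega>" for \<omega>] by (simp add: split_beta')
  have noise_coords: "noise = (\<lambda>\<omega>. from_coords (\<lambda>i. axis i 1) UNIV (\<lambda>i. noise \<omega> $ i))"
    using vec_eq_from_coords by blast
  have Z: "distributed N lborel Z (gauss \<sigma> DIM(real^'m2^'m1))"
    by (rule iid_normal_distr[OF N.prob_space_axioms iidZ \<sigma> orthonormal_family_matrix_units Z_coords])
  have Z2: "integrable N (\<lambda>\<omega>. (norm (Z \<omega>))\<^sup>2)"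
    by (rule iid_normal_norm_square_integrable[OF N.prob_space_axioms iidZ \<sigma> orthonormal_family_matrix_units(1) Z_coords])
  have noise: "distributed M lborel noise (gauss \<eta> DIM(real^'n))"
    by (rule iid_normal_distr[OF M.prob_space_axioms iid_noise \<eta> orthonormal_family_axis noise_coords])
  have noise2: "integrable M (\<lambda>\<omega>. (norm (noise \<omega>))\<^sup>2)"
    by (rule iid_normal_norm_square_integrable[OF M.prob_space_axioms iid_noise \<eta> orthonormal_family_axis(1) noise_coords])
  have [measurable]: "Z \<in> borel_measurable N" "X \<in> borel_measurable M"
    using distributed_measurable[OF Z] indep by (simp_all add: indep_random_vars_def)
  have distZ: "distr N borel Z = density lborel (gauss \<sigma> DIM(real^'m2^'m1))"
    using distributed_distr_eq_density[OF Z] by (metis distr_cong sets_lborel)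
  have distX': "distr M borel X = distr N borel (\<lambda>\<omega>. p (Z \<omega>))"
    by (simp add: distX p_def)
  \<comment> \<open>\<open>X\<close> and \<open>Z\<close> live on different probability spaces; the
    density of \<open>X\<close> is obtained through its law, the image under \<open>p\<close> of the
    law of \<open>Z\<close>.\<close>
  have "distr M borel X = distr (distr N borel Z) borel p"
    by (subst distr_distr) (simp_all add: distX' comp_def)
  also have "\<dots> = density (lborel_on S) (gauss \<sigma> (dim S))"
    unfolding distZ using porth by (intro distr_gaussian_projection[OF S \<sigma>]) (auto simp: S_range)
  finally have "distr M borel X = density (lborel_on S) (gauss \<sigma> (dim S))" .
  then have X: "distributed M (lborel_on S) X (gauss \<sigma> (dim S))"
    unfolding distributed_def by (auto cong: distr_cong)
  have X2: "integrable M (\<lambda>\<omega>. (norm (X \<omega>))\<^sup>2)"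
  proof -
    have "integrable N (\<lambda>\<omega>. (norm (p (Z \<omega>)))\<^sup>2)"
    proof (rule Bochner_Integration.integrable_bound[OF Z2])
      \<comment> \<open>Orthogonal projections are contractions:
        \<open>p W \<bullet> p W = W \<bullet> p W\<close>, and Cauchy-Schwarz applies. The second
        moment of \<open>Z\<close> thus bounds that of \<open>p Z\<close>, which has the law of
        \<open>X\<close>.\<close>
      have "norm (p W) \<le> norm W" for W
      proof -
        have "p W \<bullet> p W = W \<bullet> p W"
          using porth[of "p W" W] by (simp add: S_range inner_diff_left)
        then have "(norm (p W))\<^sup>2 \<le> norm W * norm (p W)"
          using norm_cauchy_schwarz[of W "p W"] by (simp add: power2_norm_eq_inner)
        then show ?thesis
          by (cases "p W = 0") (simp_all add: power2_eq_square)
      qed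
      then show "AE \<omega> in N. norm ((norm (p (Z \<omega>)))\<^sup>2) \<le> norm ((norm (Z \<omega>))\<^sup>2)"
        by (intro AE_I2) (simp add: power_mono)
    qed simp
    then have "integrable (distr M borel X) (\<lambda>x. (norm x)\<^sup>2)"
      unfolding distX' by (subst integrable_distr_eq) simp_all
    then show ?thesis by (subst (asm) integrable_distr_eq) simp_all
  qed
  let ?hy = "\<lambda>A. entropy_ln M lborel (observations A X noise)"
  let ?hc = "\<lambda>A. cond_entropy_ln M (lborel_on (smg_support P Q)) lborel X (observations A X noise)"
  let ?hj = "\<lambda>A. joint_entropy_ln M lborel (lborel_on (smg_support P Q)) (observations A X noise) X"
  let ?const = "entropy_ln M (lborel_on (smg_support P Q)) X + entropy_ln M lborel noise"
  have chain: "?hj A = ?const" "?hy A + ?hc A = ?hj A" for A :: "'n \<Rightarrow> real^'m2^'m1"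
  proof -
    define L where "L = (\<lambda>W. \<chi> i. A i \<bullet> W)"
    have "linear L"
      by (rule linearI) (simp_all add: L_def vec_eq_iff inner_add_right)
    then have L: "bounded_linear L" by (simp add: linear_conv_bounded_linear)
    have "observations A X noise = (\<lambda>\<omega>. L (X \<omega>) + noise \<omega>)"
      by (simp add: observations_def L_def frobenius_inner_eq_inner)
    then show "?hj A = ?const" "?hy A + ?hc A = ?hj A"
      using M.gaussian_channel_entropy[OF \<sigma> \<eta> sigma_finite_lborel_on[OF S] sets_lborel_on X X2 noise noise2 indep L]
      by (simp_all add: S_def)
  qed
  have "is_arg_max ?hy unit_power A \<longleftrightarrow> is_arg_min ?hc unit_power A" for A
  proof -
    \<comment> \<open>\<open>?hy\<close> and \<open>?hc\<close> have a sum that is the same for all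
      masks, so one rises strictly exactly when the other falls. Both kinds of extremum are defined
      by the absence of a strictly better competitor, so this comparison settles the
      equivalence.\<close>
    have "?hy A < ?hy B \<longleftrightarrow> ?hc B < ?hc A" for B
      using chain(1)[of A] chain(1)[of B] chain(2)[of A] chain(2)[of B] by linarith
    then show ?thesis by (simp add: is_arg_max_def is_arg_min_def)
  qed
  then show ?thesis using chain by simp
qed

end
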